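(* Let $\lambda$ be a partition with $d=\ell(\lambda)$ parts and $\mu$ a partition with $[\mu]\subseteq[\lambda]$. The map $\Phi$ is a bijection between $\mathcal{OOT}(\lambda/\mu)$ and $\mathcal{SF}(\lambda/\mu)$, where for $T\in\mathcal{OOT}(\lambda/\mu)$, $\Phi(T)$ is the tableau $U$ of shape $\lambda/\mu$ such that, for each $i=1,\dots,\lambda_1$, the entries in the $i$th column of $U$ are the integers $k\in\{1,\dots,\lambda'_i\}$ such that $d+1-k$ is not an entry in the $i$th column of $T$ (arranged in increasing order from top to bottom).
   Context: $\mathcal{OOT}(\lambda/\mu)$ is the set of semistandard Young tableaux $T$ of shape $\mu$ (positive integer entries, rows weakly and columns strictly increasing) with entries at most $d$ such that $c(u)<\lambda_{d+1-T(u)}$ for all $u\in[\mu]$, where $c(i,j)=j-i$. $\mathcal{SF}(\lambda/\mu)$ is the set of semistandard Young tableaux $U$ of skew shape $\lambda/\mu$ with $U(i,j)\le i$ for all $(i,j)\in[\lambda/\mu]$. $\lambda'$ is the conjugate partition of $\lambda$. For $i>\mu_1$ the $i$th column of $T$ is empty. *)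

theory Defs
  imports Complex_Main "HOL-Library.FuncSet"
begin

text \<open>A partition is the weakly decreasing list of its nonzero parts; the empty list is the
  empty partition, and the number of parts is \<^const>\<open>length\<close>.\<close>

definition is_partition :: "nat list \<Rightarrow> bool" where
  "is_partition lam \<longleftrightarrow> sorted_wrt (\<ge>) lam \<and> 0 \<notin> set lam"

text \<open>Parts are numbered from 1 and vanish beyond the length.\<close>

definition part :: "nat list \<Rightarrow> nat \<Rightarrow> nat" where
  "part lam i = (if 1 \<le> i \<and> i \<le> length lam then lam ! (i - 1) else 0)"

definition conjugate :: "nat list \<Rightarrow> nat list" where
  "conjugate lam =
     map (\<lambda>j. card {i \<in> {1..length lam}. j \<le> part lam i}) [1..<Suc (part lam 1)]"

text \<open>English convention: the cell \<open>(i, j)\<close> lies in row \<open>i\<close> (counted from the top) and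
  column \<open>j\<close>, both numbered from 1.\<close>

definition diagram :: "nat list \<Rightarrow> (nat \<times> nat) set" where
  "diagram lam = {(i, j). 1 \<le> i \<and> i \<le> length lam \<and> 1 \<le> j \<and> j \<le> part lam i}"

definition skew_diagram :: "nat list \<Rightarrow> nat list \<Rightarrow> (nat \<times> nat) set" where
  "skew_diagram lam mu = diagram lam - diagram mu"

definition content :: "nat \<times> nat \<Rightarrow> int" where
  "content u = int (snd u) - int (fst u)"

text \<open>Fillings are \<^const>\<open>undefined\<close> outside their shape, so that a filling is determined by its
  entries on the cells.\<close>

definition fillings :: "(nat \<times> nat) set \<Rightarrow> (nat \<times> nat \<Rightarrow> nat) set" where
  "fillings D = D \<rightarrow>\<^sub>E {1..}"

definition rows_weakly_increasing :: "(nat \<times> nat) set \<Rightarrow> (nat \<times> nat \<Rightarrow> nat) \<Rightarrow> bool" where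
  "rows_weakly_increasing D T \<longleftrightarrow>
     (\<forall>i j j'. (i, j) \<in> D \<longrightarrow> (i, j') \<in> D \<longrightarrow> j < j' \<longrightarrow> T (i, j) \<le> T (i, j'))"

definition columns_strictly_increasing :: "(nat \<times> nat) set \<Rightarrow> (nat \<times> nat \<Rightarrow> nat) \<Rightarrow> bool" where
  "columns_strictly_increasing D T \<longleftrightarrow>
     (\<forall>i i' j. (i, j) \<in> D \<longrightarrow> (i', j) \<in> D \<longrightarrow> i < i' \<longrightarrow> T (i, j) < T (i', j))"

definition SSYT :: "(nat \<times> nat) set \<Rightarrow> (nat \<times> nat \<Rightarrow> nat) set" where
  "SSYT D = {T \<in> fillings D. rows_weakly_increasing D T \<and> columns_strictly_increasing D T}"

definition column_entries :: "(nat \<times> nat) set \<Rightarrow> (nat \<times> nat \<Rightarrow> nat) \<Rightarrow> nat \<Rightarrow> nat set" where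
  "column_entries D T j = {T (i, j) | i. (i, j) \<in> D}"

text \<open>The index \<open>length lam + 1 - T u\<close> is a truncated subtraction on \<^typ>\<open>nat\<close>, which is harmless
  because \<open>T u \<le> length lam\<close>.\<close>

definition OOT :: "nat list \<Rightarrow> nat list \<Rightarrow> (nat \<times> nat \<Rightarrow> nat) set" where
  "OOT lam mu = {T \<in> SSYT (diagram mu). \<forall>u \<in> diagram mu.
     T u \<le> length lam \<and> content u < int (part lam (length lam + 1 - T u))}"

definition SF :: "nat list \<Rightarrow> nat list \<Rightarrow> (nat \<times> nat \<Rightarrow> nat) set" where
  "SF lam mu = {U \<in> SSYT (skew_diagram lam mu).
     \<forall>(i, j) \<in> skew_diagram lam mu. U (i, j) \<le> i}"

text \<open>Since columns increase strictly, prescribing the set of entries of a column says that these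
  entries are listed once each in increasing order from top to bottom. That rows of \<open>U\<close> increase
  weakly is not required here.\<close>

definition is_Phi_image ::
    "nat list \<Rightarrow> nat list \<Rightarrow> (nat \<times> nat \<Rightarrow> nat) \<Rightarrow> (nat \<times> nat \<Rightarrow> nat) \<Rightarrow> bool" where
  "is_Phi_image lam mu T U \<longleftrightarrow>
     U \<in> fillings (skew_diagram lam mu) \<and>
     columns_strictly_increasing (skew_diagram lam mu) U \<and>
     (\<forall>i \<in> {1..part lam 1}. column_entries (skew_diagram lam mu) U i =
        {k \<in> {1..part (conjugate lam) i}.
           length lam + 1 - k \<notin> column_entries (diagram mu) T i})"

definition Phi :: "nat list \<Rightarrow> nat list \<Rightarrow> (nat \<times> nat \<Rightarrow> nat) \<Rightarrow> (nat \<times> nat \<Rightarrow> nat)" where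
  "Phi lam mu T = (THE U. is_Phi_image lam mu T U)"

end

theory Submission
  imports Defs
begin

text \<open>
  A filling with strictly increasing columns is the same thing as the family of its column sets,
  so everything is phrased in terms of those sets. Write \<open>c\<^sub>j\<close> and \<open>p\<^sub>j\<close> for the heights
  \<open>\<lambda>'\<^sub>j\<close> and \<open>\<mu>'\<^sub>j\<close> of the \<open>j\<close>th columns and \<open>d\<close> for the number of parts of \<open>\<lambda>\<close>.

  The two side conditions only bound the column sets. The condition \<open>c(u) < \<lambda>\<^bsub>d+1-T(u)\<^esub>\<close> for a
  cell of the top row says exactly that \<open>d + 1 - T(u) \<le> c\<^sub>j\<close>, and for the lower cells of a column it
  then follows; so it means that the set \<open>E\<^sub>j\<close> of entries in column \<open>j\<close> of \<open>T\<close> lies in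
  \<open>{d + 1 - c\<^sub>j..d}\<close>. Since column \<open>j\<close> of \<open>\<lambda>/\<mu>\<close> ends in row \<open>c\<^sub>j\<close>, the flag condition
  \<open>U(i, j) \<le> i\<close> means that the set \<open>B\<^sub>j\<close> of entries in column \<open>j\<close> of \<open>U\<close> lies in \<open>{1..c\<^sub>j}\<close>.
  The map \<open>\<Phi>\<close> reflects \<open>E\<^sub>j\<close> into \<open>{1..c\<^sub>j}\<close> and takes the complement there. This is an invertible
  operation that turns sets of size \<open>p\<^sub>j\<close> into sets of size \<open>c\<^sub>j - p\<^sub>j\<close>, so on fillings without a
  condition on rows the bijection is immediate.

  It remains to see that the rows of \<open>T\<close> increase weakly if and only if those of \<open>U\<close> do. If a column
  occupies the rows \<open>p + 1, ..., q\<close> and has the set of entries \<open>S\<close>, then the entry in row \<open>i\<close> is at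
  most \<open>m\<close> if and only if \<open>i \<le> p + |S \<inter> {..m}|\<close> (lemma \<open>entry_le_iff\<close>). Hence rows increase weakly
  if and only if this number decreases weakly from left to right for every \<open>m\<close>
  (lemma \<open>rows_weakly_increasing_iff\<close>). For \<open>k \<le> c\<^sub>j\<close> complementation gives
  \<open>p\<^sub>j + |B\<^sub>j \<inter> {..k}| = k + |E\<^sub>j \<inter> {..d - k}|\<close>, so the two families of inequalities agree
  (lemma \<open>dominance_reflected_complement\<close>).
\<close>

section \<open>Column-strict fillings and their column sets\<close>

text \<open>Column \<open>j\<close> consists of the rows \<open>p j + 1, ..., q j\<close>. Both straight and skew diagrams have this
  form, which puts the two sides of the bijection on the same footing.\<close>

definition column_shape :: "(nat \<Rightarrow> nat) \<Rightarrow> (nat \<Rightarrow> nat) \<Rightarrow> (nat \<times> nat) set" where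
  "column_shape p q = {(i, j). 1 \<le> j \<and> p j < i \<and> i \<le> q j}"

lemma mem_column_shape [simp]: "(i, j) \<in> column_shape p q \<longleftrightarrow> 1 \<le> j \<and> p j < i \<and> i \<le> q j"
  by (simp add: column_shape_def)

lemma column_entries_column_shape:
  assumes "1 \<le> j"
  shows "column_entries (column_shape p q) U j = (\<lambda>i. U (i, j)) ` {p j<..q j}"
  using assms by (auto simp: column_entries_def)

lemma column_strictD:
  assumes "columns_strictly_increasing D U" "(i, j) \<in> D" "(i', j) \<in> D" "i < i'"
  shows "U (i, j) < U (i', j)"
  using assms unfolding columns_strictly_increasing_def by blast

lemma inj_on_column:
  assumes "columns_strictly_increasing (column_shape p q) U" "1 \<le> j"
  shows "inj_on (\<lambda>i. U (i, j)) {p j<..q j}"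
proof (rule linorder_inj_onI)
  fix x y assume "x < y" "x \<in> {p j<..q j}" "y \<in> {p j<..q j}"
  then show "U (x, j) \<noteq> U (y, j)"
    using column_strictD[OF assms(1), of x j y] assms(2) by auto
qed auto

lemma card_column_entries:
  assumes "columns_strictly_increasing (column_shape p q) U" "1 \<le> j"
  shows "card (column_entries (column_shape p q) U j) = q j - p j"
  by (simp add: column_entries_column_shape[OF assms(2)] card_image[OF inj_on_column[OF assms]])

lemma finite_column_entries:
  "1 \<le> j \<Longrightarrow> finite (column_entries (column_shape p q) U j)"
  by (simp add: column_entries_column_shape)

text \<open>The entries at most \<open>m\<close> of an increasing column fill an initial segment of it, so their number
  tells where that segment ends. This expresses individual entries through the column set.\<close>

lemma entry_le_iff:
  assumes strict: "columns_strictly_increasing (column_shape p q) U"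
    and cell: "(i, j) \<in> column_shape p q"
  shows "U (i, j) \<le> m \<longleftrightarrow> i \<le> p j + card (column_entries (column_shape p q) U j \<inter> {..m})"
proof -
  have j: "1 \<le> j" and i: "p j < i" "i \<le> q j"
    using cell by auto
  define I where "I = {r \<in> {p j<..q j}. U (r, j) \<le> m}"
  have fin: "finite I"
    by (simp add: I_def)
  have "column_entries (column_shape p q) U j \<inter> {..m} = (\<lambda>r. U (r, j)) ` I"
    by (auto simp: column_entries_column_shape[OF j] I_def)
  moreover have "inj_on (\<lambda>r. U (r, j)) I"
    by (rule inj_on_subset[OF inj_on_column[OF strict j]]) (auto simp: I_def)
  ultimately have card: "card (column_entries (column_shape p q) U j \<inter> {..m}) = card I"
    by (simp add: card_image)
  show ?thesis
  proof (cases "U (i, j) \<le> m")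
    case True
    have "{p j<..i} \<subseteq> I"
    proof
      fix r assume r: "r \<in> {p j<..i}"
      then have "U (r, j) \<le> U (i, j)"
        using column_strictD[OF strict, of r j i] i j by (cases "r = i") auto
      with r True i show "r \<in> I"
        by (auto simp: I_def)
    qed
    then have "i - p j \<le> card I"
      using card_mono[OF fin, of "{p j<..i}"] by simp
    with True card i show ?thesis
      by auto
  next
    case False
    have "I \<subseteq> {p j<..<i}"
    proof
      fix r assume r: "r \<in> I"
      have "r < i"
      proof (rule ccontr)
        assume "\<not> r < i"
        then have "U (i, j) \<le> U (r, j)"
          using column_strictD[OF strict, of i j r] i j r by (cases "r = i") (auto simp: I_def)
        with r False show False
          by (auto simp: I_def)
      qed
      with r show "r \<in> {p j<..<i}"
        by (auto simp: I_def)
    qed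
    then have "card I \<le> i - Suc (p j)"
      using card_mono[of "{p j<..<i}" I] by simp
    with False card i show ?thesis
      by auto
  qed
qed

text \<open>By \<open>entry_le_iff\<close> the column sets determine every entry.\<close>

lemma column_strict_filling_unique:
  assumes U: "U \<in> fillings (column_shape p q)" "columns_strictly_increasing (column_shape p q) U"
    and V: "V \<in> fillings (column_shape p q)" "columns_strictly_increasing (column_shape p q) V"
    and same: "\<And>j. 1 \<le> j \<Longrightarrow>
      column_entries (column_shape p q) U j = column_entries (column_shape p q) V j"
  shows "U = V"
proof
  fix u :: "nat \<times> nat"
  obtain i j where u: "u = (i, j)"
    by (cases u)
  show "U u = V u"
  proof (cases "u \<in> column_shape p q")
    case True
    then have cell: "(i, j) \<in> column_shape p q" and "1 \<le> j"
      using u by auto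
    then have "U (i, j) \<le> m \<longleftrightarrow> V (i, j) \<le> m" for m
      by (simp add: entry_le_iff[OF U(2) cell] entry_le_iff[OF V(2) cell] same)
    from this[of "U (i, j)"] this[of "V (i, j)"] u show ?thesis
      by simp
  next
    case False
    with U(1) V(1) show ?thesis
      unfolding fillings_def by (metis PiE_arb)
  qed
qed

text \<open>Conversely, sets of the right sizes are realised by sorting each of them down its column.\<close>

lemma column_strict_filling_exists:
  assumes S: "\<And>j. 1 \<le> j \<Longrightarrow> finite (S j) \<and> S j \<subseteq> {1..} \<and> card (S j) = q j - p j"
  shows "\<exists>U. U \<in> fillings (column_shape p q) \<and>
    columns_strictly_increasing (column_shape p q) U \<and>
    (\<forall>j \<ge> 1. column_entries (column_shape p q) U j = S j)"
proof (intro exI conjI allI impI)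
  define U where "U = restrict (\<lambda>(i, j). sorted_list_of_set (S j) ! (i - Suc (p j)))
    (column_shape p q)"
  have eq: "U (i, j) = sorted_list_of_set (S j) ! (i - Suc (p j))"
    if "(i, j) \<in> column_shape p q" for i j
    using that by (simp add: U_def)
  show entries: "column_entries (column_shape p q) U j = S j" if j: "1 \<le> j" for j
  proof -
    have "(\<lambda>i. U (i, j)) ` {p j<..q j} =
        (\<lambda>i. sorted_list_of_set (S j) ! (i - Suc (p j))) ` {p j<..q j}"
      using j by (intro image_cong refl eq) auto
    also have "\<dots> = (!) (sorted_list_of_set (S j)) ` (\<lambda>i. i - Suc (p j)) ` {p j<..q j}"
      by (simp add: image_image)
    also have "(\<lambda>i. i - Suc (p j)) ` {p j<..q j} = {0..<q j - p j}"
    proof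
      show "{0..<q j - p j} \<subseteq> (\<lambda>i. i - Suc (p j)) ` {p j<..q j}"
      proof
        fix t assume "t \<in> {0..<q j - p j}"
        then show "t \<in> (\<lambda>i. i - Suc (p j)) ` {p j<..q j}"
          by (intro image_eqI[of _ _ "t + Suc (p j)"]) auto
      qed
    qed auto
    also have "(!) (sorted_list_of_set (S j)) ` {0..<q j - p j} = S j"
      using S[OF j] nth_image[of "q j - p j" "sorted_list_of_set (S j)"] by simp
    finally show ?thesis
      by (simp add: column_entries_column_shape[OF j])
  qed
  show "columns_strictly_increasing (column_shape p q) U"
    unfolding columns_strictly_increasing_def
  proof (intro allI impI)
    fix i i' j
    assume c: "(i, j) \<in> column_shape p q" "(i', j) \<in> column_shape p q" "i < i'"
    then have "i - Suc (p j) < i' - Suc (p j)" "i' - Suc (p j) < card (S j)"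
      using S[of j] by auto
    then show "U (i, j) < U (i', j)"
      unfolding eq[OF c(1)] eq[OF c(2)]
      using sorted_wrt_nth_less[OF strict_sorted_list_of_set[of "S j"]] by simp
  qed
  show "U \<in> fillings (column_shape p q)"
    unfolding fillings_def
  proof (rule PiE_I)
    fix u assume u: "u \<in> column_shape p q"
    obtain i j where ij: "u = (i, j)"
      by (cases u)
    with u have j: "1 \<le> j" and "U u \<in> column_entries (column_shape p q) U j"
      by (auto simp: column_entries_column_shape)
    with S[OF j] show "U u \<in> {1..}"
      unfolding entries[OF j] by blast
  qed (simp add: U_def)
qed

text \<open>The rows of column \<open>j\<close> that lie above the shape or have an entry at most \<open>m\<close> are the first
  \<open>p j + |S\<^sub>j \<inter> {..m}|\<close> rows; rows increase weakly when these initial segments shrink from left to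
  right. Counting the empty cells above the shape is what makes the criterion uniform.\<close>

lemma rows_weakly_increasing_iff:
  fixes p q U
  defines "N \<equiv> \<lambda>j m. p j + card (column_entries (column_shape p q) U j \<inter> {..m})"
  assumes strict: "columns_strictly_increasing (column_shape p q) U"
    and pq: "\<And>j. 1 \<le> j \<Longrightarrow> p j \<le> q j"
    and p: "\<And>j j'. 1 \<le> j \<Longrightarrow> j \<le> j' \<Longrightarrow> p j' \<le> p j"
    and q: "\<And>j j'. 1 \<le> j \<Longrightarrow> j \<le> j' \<Longrightarrow> q j' \<le> q j"
  shows "rows_weakly_increasing (column_shape p q) U \<longleftrightarrow>
    (\<forall>j j' m. 1 \<le> j \<longrightarrow> j < j' \<longrightarrow> N j' m \<le> N j m)"
proof (intro iffI allI impI)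
  fix j j' m :: nat
  assume rows: "rows_weakly_increasing (column_shape p q) U" and j: "1 \<le> j" "j < j'"
  then have j': "1 \<le> j'"
    by simp
  have "card (column_entries (column_shape p q) U j' \<inter> {..m}) \<le> q j' - p j'"
    using card_mono[OF finite_column_entries[OF j'], of _ p q U]
    by (simp add: card_column_entries[OF strict j', symmetric])
  then have le: "N j' m \<le> q j'"
    using pq[OF j'] by (simp add: N_def)
  show "N j' m \<le> N j m"
  proof (cases "N j' m \<le> p j")
    case True
    then show ?thesis
      by (simp add: N_def)
  next
    case False
    \<comment> \<open>The last row of the initial segment of column \<open>j'\<close> then meets the shape in both columns.\<close>
    have cells: "(N j' m, j) \<in> column_shape p q" "(N j' m, j') \<in> column_shape p q"
      using False le j j' p[of j j'] q[of j j'] by auto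
    have "U (N j' m, j) \<le> U (N j' m, j')"
      using rows cells j unfolding rows_weakly_increasing_def by blast
    also have "\<dots> \<le> m"
      using entry_le_iff[OF strict cells(2), of m] by (simp add: N_def)
    finally show ?thesis
      using entry_le_iff[OF strict cells(1), of m] by (simp add: N_def)
  qed
next
  assume N: "\<forall>j j' m. 1 \<le> j \<longrightarrow> j < j' \<longrightarrow> N j' m \<le> N j m"
  show "rows_weakly_increasing (column_shape p q) U"
    unfolding rows_weakly_increasing_def
  proof (intro allI impI)
    fix i j j'
    assume cells: "(i, j) \<in> column_shape p q" "(i, j') \<in> column_shape p q" and "j < j'"
    have "i \<le> N j' (U (i, j'))"
      using entry_le_iff[OF strict cells(2), of "U (i, j')"] by (simp add: N_def)
    also have "\<dots> \<le> N j (U (i, j'))"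
      using N cells \<open>j < j'\<close> by simp
    finally show "U (i, j) \<le> U (i, j')"
      using entry_le_iff[OF strict cells(1)] by (simp add: N_def)
  qed
qed

section \<open>Reflected complements\<close>

definition reflected_complement :: "nat \<Rightarrow> nat \<Rightarrow> nat set \<Rightarrow> nat set" where
  "reflected_complement d c E = {k \<in> {1..c}. d + 1 - k \<notin> E}"

lemma reflected_complement_involution:
  assumes "c \<le> d" "E \<subseteq> {d + 1 - c..d}"
  shows "E = {e \<in> {d + 1 - c..d}. d + 1 - e \<notin> reflected_complement d c E}"
proof -
  have "e \<in> E \<longleftrightarrow> d + 1 - e \<notin> reflected_complement d c E" if "e \<in> {d + 1 - c..d}" for e
  proof -
    have "d + 1 - (d + 1 - e) = e" "d + 1 - e \<in> {1..c}"
      using that assms(1) by auto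
    then show ?thesis
      by (simp add: reflected_complement_def)
  qed
  with assms(2) show ?thesis
    by blast
qed

lemma reflected_complement_surj:
  assumes "c \<le> d" "B \<subseteq> {1..c}"
  shows "reflected_complement d c {e \<in> {d + 1 - c..d}. d + 1 - e \<notin> B} = B"
proof -
  have "k \<in> B \<longleftrightarrow> d + 1 - k \<notin> {e \<in> {d + 1 - c..d}. d + 1 - e \<notin> B}" if "k \<in> {1..c}" for k
  proof -
    have "d + 1 - (d + 1 - k) = k" "d + 1 - k \<in> {d + 1 - c..d}"
      using that assms(1) by auto
    then show ?thesis
      by simp
  qed
  with assms(2) show ?thesis
    unfolding reflected_complement_def by blast
qed

text \<open>The elements of \<open>{1..k}\<close> outside the reflected complement are the reflections of the elements of
  \<open>E\<close> above \<open>d - k\<close>.\<close>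

lemma card_reflected_complement_atMost:
  assumes "c \<le> d" "E \<subseteq> {d + 1 - c..d}" "k \<le> c"
  shows "card E + card (reflected_complement d c E \<inter> {..k}) = k + card (E \<inter> {..d - k})"
proof -
  have fin: "finite E"
    using assms(2) finite_subset by blast
  let ?R = "(\<lambda>e. d + 1 - e) ` (E \<inter> {d - k<..})"
  have inj: "inj_on (\<lambda>e. d + 1 - e) (E \<inter> {d - k<..})"
    using assms(2) by (intro inj_onI) (fastforce)
  have split: "{1..k} = (reflected_complement d c E \<inter> {..k}) \<union> ?R"
  proof
    show "{1..k} \<subseteq> (reflected_complement d c E \<inter> {..k}) \<union> ?R"
    proof
      fix x assume x: "x \<in> {1..k}"
      show "x \<in> (reflected_complement d c E \<inter> {..k}) \<union> ?R"
      proof (cases "d + 1 - x \<in> E")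
        case True
        have "x \<in> ?R"
          by (rule image_eqI[of _ _ "d + 1 - x"]) (use x True assms in auto)
        then show ?thesis ..
      qed (use x assms(3) in \<open>auto simp: reflected_complement_def\<close>)
    qed
    show "(reflected_complement d c E \<inter> {..k}) \<union> ?R \<subseteq> {1..k}"
      using assms by (fastforce simp: reflected_complement_def)
  qed
  have "d + 1 - (d + 1 - e) = e" if "e \<in> E" for e
    using that assms(2) by fastforce
  then have "(reflected_complement d c E \<inter> {..k}) \<inter> ?R = {}"
    by (auto simp: reflected_complement_def)
  then have "card {1..k} = card (reflected_complement d c E \<inter> {..k}) + card ?R"
    unfolding split using fin by (intro card_Un_disjoint) auto
  moreover have "card ?R = card (E \<inter> {d - k<..})"
    by (rule card_image[OF inj])
  moreover have "card E = card (E \<inter> {..d - k}) + card (E \<inter> {d - k<..})"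
    using fin by (subst card_Un_disjoint[symmetric]) (auto intro!: arg_cong[of _ _ card])
  ultimately show ?thesis
    by simp
qed

lemma card_reflected_complement:
  assumes "c \<le> d" "E \<subseteq> {d + 1 - c..d}"
  shows "card E + card (reflected_complement d c E) = c"
proof -
  have "E \<inter> {..d - c} = {}"
    using assms by fastforce
  moreover have "reflected_complement d c E \<inter> {..c} = reflected_complement d c E"
    by (auto simp: reflected_complement_def)
  ultimately show ?thesis
    using card_reflected_complement_atMost[OF assms order_refl] by simp
qed

text \<open>As long as \<open>k \<le> c'\<close>, adding \<open>k\<close> to both sides of the inequality on the left for \<open>m = d - k\<close>
  gives the one on the right for \<open>k\<close>. The remaining inequalities are consequences: the smaller side
  is constant for \<open>k \<ge> c'\<close> and for \<open>m \<ge> d\<close>, whereas the larger one can only grow, and the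
  smaller side vanishes for \<open>m \<le> d - c'\<close>.\<close>

lemma dominance_reflected_complement:
  assumes c: "c' \<le> c" "c \<le> d"
    and E: "E \<subseteq> {d + 1 - c..d}" and E': "E' \<subseteq> {d + 1 - c'..d}"
  shows "(\<forall>m. card (E' \<inter> {..m}) \<le> card (E \<inter> {..m})) \<longleftrightarrow>
    (\<forall>k. card E' + card (reflected_complement d c' E' \<inter> {..k})
       \<le> card E + card (reflected_complement d c E \<inter> {..k}))"
    (is "(\<forall>m. ?L' m \<le> ?L m) \<longleftrightarrow> (\<forall>k. ?R' k \<le> ?R k)")
proof -
  have shift: "?R' k = k + ?L' (d - k)" "?R k = k + ?L (d - k)" if "k \<le> c'" for k
    using card_reflected_complement_atMost[OF _ E', of k]
      card_reflected_complement_atMost[OF _ E, of k] c that by auto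
  have fin: "finite E"
    using E finite_subset by blast
  show ?thesis
  proof (intro iffI allI)
    fix k assume L: "\<forall>m. ?L' m \<le> ?L m"
    show "?R' k \<le> ?R k"
    proof (cases "k \<le> c'")
      case True
      then show ?thesis
        using L by (simp add: shift)
    next
      case False
      then have "reflected_complement d c' E' \<inter> {..k} = reflected_complement d c' E' \<inter> {..c'}"
        by (auto simp: reflected_complement_def)
      then have "?R' k = ?R' c'"
        by simp
      also have "\<dots> \<le> ?R c'"
        using L by (simp add: shift)
      also have "\<dots> \<le> ?R k"
        using False by (intro add_left_mono card_mono) (auto simp: reflected_complement_def)
      finally show ?thesis .
    qed
  next
    fix m assume R: "\<forall>k. ?R' k \<le> ?R k"
    have main: "?L' (d - k) \<le> ?L (d - k)" if "k \<le> c'" for k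
      using R[rule_format, of k] shift[OF that] by simp
    consider "m < d + 1 - c'" | "d + 1 - c' \<le> m" "m \<le> d" | "d < m"
      by linarith
    then show "?L' m \<le> ?L m"
    proof cases
      case 1
      then have "E' \<inter> {..m} = {}"
        using E' by fastforce
      then show ?thesis
        by simp
    next
      case 2
      then show ?thesis
        using main[of "d - m"] by simp
    next
      case 3
      have "E' \<inter> {..m} = E' \<inter> {..d}"
        using 3 E' by fastforce
      then have "?L' m = ?L' d"
        by simp
      also have "\<dots> \<le> ?L d"
        using main[of 0] by simp
      also have "\<dots> \<le> ?L m"
        using 3 fin by (intro card_mono) auto
      finally show ?thesis .
    qed
  qed
qed

section \<open>Diagrams of partitions by columns\<close>

lemma part_antimono:
  assumes "is_partition lam" "1 \<le> i" "i \<le> i'"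
  shows "part lam i' \<le> part lam i"
proof (cases "i' \<le> length lam \<and> i < i'")
  case True
  then have "lam ! (i' - 1) \<le> lam ! (i - 1)"
    using assms sorted_wrt_nth_less[of "(\<ge>)" lam "i - 1" "i' - 1"]
    by (auto simp: is_partition_def)
  with True assms show ?thesis
    by (simp add: part_def)
qed (use assms in \<open>auto simp: part_def not_less\<close>)

lemma part_conjugate_eq_0: "part lam 1 < j \<Longrightarrow> part (conjugate lam) j = 0"
  unfolding part_def[of "conjugate lam"] by (simp add: conjugate_def)

lemma le_part_conjugate_iff:
  assumes lam: "is_partition lam" and i: "1 \<le> i" and j: "1 \<le> j"
  shows "i \<le> part (conjugate lam) j \<longleftrightarrow> i \<le> length lam \<and> j \<le> part lam i"
proof (cases "j \<le> part lam 1")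
  case True
  define I where "I = {r \<in> {1..length lam}. j \<le> part lam r}"
  have c: "part (conjugate lam) j = card I"
    unfolding part_def[of "conjugate lam"]
    using True j nth_upt[of 1 "j - 1" "Suc (part lam 1)"]
    by (simp add: conjugate_def I_def del: upt_Suc)
  have fin: "finite I"
    by (simp add: I_def)
  show ?thesis
  proof (cases "i \<le> length lam \<and> j \<le> part lam i")
    case True
    have "{1..i} \<subseteq> I"
      using True part_antimono[OF lam] by (fastforce simp: I_def)
    then have "i \<le> card I"
      using card_mono[OF fin, of "{1..i}"] by simp
    with True c show ?thesis
      by simp
  next
    case False
    have "I \<subseteq> {1..<i}"
    proof
      fix r assume r: "r \<in> I"
      have "\<not> i \<le> r"
      proof
        assume "i \<le> r"
        then show False
          using r False part_antimono[OF lam i, of r] by (auto simp: I_def)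
      qed
      with r show "r \<in> {1..<i}"
        by (auto simp: I_def)
    qed
    then have "card I \<le> i - 1"
      using card_mono[of "{1..<i}" I] by simp
    with False c i show ?thesis
      by auto
  qed
next
  case False
  then have "part (conjugate lam) j = 0"
    by (simp add: part_conjugate_eq_0)
  moreover have "\<not> j \<le> part lam i"
    using False part_antimono[OF lam order_refl i] by simp
  ultimately show ?thesis
    using i by simp
qed

lemma part_conjugate_antimono:
  assumes "is_partition lam" "1 \<le> j" "j \<le> j'"
  shows "part (conjugate lam) j' \<le> part (conjugate lam) j"
proof (cases "part (conjugate lam) j' = 0")
  case False
  then show ?thesis
    using assms le_part_conjugate_iff[of lam "part (conjugate lam) j'" j']
      le_part_conjugate_iff[of lam "part (conjugate lam) j'" j] by auto
qed simp

lemma part_conjugate_le_length: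
  assumes "is_partition lam" "1 \<le> j"
  shows "part (conjugate lam) j \<le> length lam"
proof (cases "part (conjugate lam) j = 0")
  case False
  then show ?thesis
    using assms le_part_conjugate_iff[of lam "part (conjugate lam) j" j] by auto
qed simp

lemma diagram_eq_column_shape:
  assumes "is_partition lam"
  shows "diagram lam = column_shape (\<lambda>_. 0) (part (conjugate lam))"
  using le_part_conjugate_iff[OF assms] by (fastforce simp: diagram_def)

lemma skew_diagram_eq_column_shape:
  assumes "is_partition lam" "is_partition mu"
  shows "skew_diagram lam mu = column_shape (part (conjugate mu)) (part (conjugate lam))"
  by (auto simp: skew_diagram_def diagram_eq_column_shape assms)

lemma part_conjugate_mono:
  assumes lam: "is_partition lam" and mu: "is_partition mu" and "diagram mu \<subseteq> diagram lam" "1 \<le> j"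
  shows "part (conjugate mu) j \<le> part (conjugate lam) j"
proof (cases "part (conjugate mu) j = 0")
  case False
  then have "(part (conjugate mu) j, j) \<in> diagram mu"
    using assms by (simp add: diagram_eq_column_shape)
  then have "(part (conjugate mu) j, j) \<in> diagram lam"
    using assms by blast
  then show ?thesis
    using lam by (simp add: diagram_eq_column_shape)
qed simp

section \<open>The side conditions in terms of column sets\<close>

text \<open>The content condition on \<open>(1, j)\<close> is \<open>j \<le> part lam (d + 1 - T (1, j))\<close>, that is, the lower
  bound on \<open>T (1, j)\<close>; moving down a column the entry grows and the content drops, so the top cell
  carries the strongest condition.\<close>

lemma OOT_iff:
  assumes lam: "is_partition lam" and mu: "is_partition mu"
  shows "T \<in> OOT lam mu \<longleftrightarrow> T \<in> SSYT (diagram mu) \<and>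
    (\<forall>j \<ge> 1. column_entries (diagram mu) T j
       \<subseteq> {length lam + 1 - part (conjugate lam) j..length lam})"
proof (intro iffI conjI allI impI subsetI)
  assume T: "T \<in> OOT lam mu"
  then show ssyt: "T \<in> SSYT (diagram mu)"
    by (simp add: OOT_def)
  fix j e :: nat assume j: "1 \<le> j" and "e \<in> column_entries (diagram mu) T j"
  then obtain i where e: "e = T (i, j)" and cell: "(i, j) \<in> diagram mu"
    by (auto simp: column_entries_def)
  then have top: "(1, j) \<in> diagram mu" and i: "1 \<le> i"
    by (auto simp: diagram_eq_column_shape[OF mu])
  have strict: "columns_strictly_increasing (diagram mu) T"
    using ssyt by (simp add: SSYT_def)
  have le: "T (1, j) \<le> T (i, j)"
    using column_strictD[OF strict top cell] i by (cases "i = 1") auto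
  have bounds: "T u \<le> length lam" "content u < int (part lam (length lam + 1 - T u))"
    if "u \<in> diagram mu" for u
    using T that by (auto simp: OOT_def)
  have "1 \<le> T (1, j)"
    using ssyt top by (auto simp: SSYT_def fillings_def)
  moreover have "j \<le> part lam (length lam + 1 - T (1, j))"
    using bounds(2)[OF top] by (simp add: content_def)
  ultimately have "length lam + 1 - T (1, j) \<le> part (conjugate lam) j"
    using bounds(1)[OF top] by (subst le_part_conjugate_iff[OF lam _ j]) auto
  with bounds(1)[OF cell] le e
  show "e \<in> {length lam + 1 - part (conjugate lam) j..length lam}"
    by auto
next
  assume *: "T \<in> SSYT (diagram mu) \<and> (\<forall>j \<ge> 1. column_entries (diagram mu) T j
    \<subseteq> {length lam + 1 - part (conjugate lam) j..length lam})"
  have "T u \<le> length lam \<and> content u < int (part lam (length lam + 1 - T u))"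
    if u: "u \<in> diagram mu" for u
  proof -
    obtain i j where ij: "u = (i, j)"
      by (cases u)
    with u have i: "1 \<le> i" and j: "1 \<le> j"
      by (auto simp: diagram_def)
    have "T u \<in> column_entries (diagram mu) T j"
      using u ij by (auto simp: column_entries_def)
    then have b: "length lam + 1 - part (conjugate lam) j \<le> T u" "T u \<le> length lam"
      using * j by fastforce+
    then have "length lam + 1 - T u \<le> part (conjugate lam) j"
      by linarith
    then have "j \<le> part lam (length lam + 1 - T u)"
      using le_part_conjugate_iff[OF lam _ j, of "length lam + 1 - T u"] b by auto
    with b i ij show ?thesis
      by (simp add: content_def)
  qed
  with * show "T \<in> OOT lam mu"
    by (simp add: OOT_def)
qed

text \<open>Column \<open>j\<close> of the skew diagram ends in row \<open>c\<^sub>j = part (conjugate lam) j\<close>. If its distinct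
  entries lie in \<open>{1..c\<^sub>j}\<close>, then at most \<open>c\<^sub>j - i\<close> of them exceed \<open>i\<close>; they occupy rows at the
  bottom of the column, which therefore lie below row \<open>i\<close>.\<close>

lemma SF_iff:
  assumes lam: "is_partition lam" and mu: "is_partition mu"
  shows "U \<in> SF lam mu \<longleftrightarrow> U \<in> SSYT (skew_diagram lam mu) \<and>
    (\<forall>j \<ge> 1. column_entries (skew_diagram lam mu) U j \<subseteq> {1..part (conjugate lam) j})"
proof (intro iffI conjI allI impI subsetI)
  assume U: "U \<in> SF lam mu"
  then show ssyt: "U \<in> SSYT (skew_diagram lam mu)"
    by (simp add: SF_def)
  fix j e assume "1 \<le> j" and "e \<in> column_entries (skew_diagram lam mu) U j"
  then obtain i where e: "e = U (i, j)" and cell: "(i, j) \<in> skew_diagram lam mu"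
    by (auto simp: column_entries_def)
  have "1 \<le> U (i, j)"
    using ssyt cell by (auto simp: SSYT_def fillings_def)
  moreover have "U (i, j) \<le> i"
    using U cell by (auto simp: SF_def)
  moreover have "i \<le> part (conjugate lam) j"
    using cell by (simp add: skew_diagram_eq_column_shape lam mu)
  ultimately show "e \<in> {1..part (conjugate lam) j}"
    by (simp add: e)
next
  let ?p = "part (conjugate mu)" and ?q = "part (conjugate lam)"
  let ?D = "column_shape ?p ?q"
  assume "U \<in> SSYT (skew_diagram lam mu) \<and>
    (\<forall>j \<ge> 1. column_entries (skew_diagram lam mu) U j \<subseteq> {1..?q j})"
  then have ssyt: "U \<in> SSYT ?D"
    and sub: "\<And>j. 1 \<le> j \<Longrightarrow> column_entries ?D U j \<subseteq> {1..?q j}"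
    by (auto simp: skew_diagram_eq_column_shape lam mu)
  have strict: "columns_strictly_increasing ?D U"
    using ssyt by (simp add: SSYT_def)
  have "U (i, j) \<le> i" if cell: "(i, j) \<in> ?D" for i j
  proof -
    let ?S = "column_entries ?D U j"
    have j: "1 \<le> j" and i: "?p j < i" "i \<le> ?q j"
      using cell by auto
    have "?S \<subseteq> (?S \<inter> {..i}) \<union> {i<..?q j}"
      using sub[OF j] by auto
    then have "card ?S \<le> card ((?S \<inter> {..i}) \<union> {i<..?q j})"
      by (intro card_mono) simp_all
    also have "\<dots> \<le> card (?S \<inter> {..i}) + (?q j - i)"
      using card_Un_le[of "?S \<inter> {..i}" "{i<..?q j}"] by simp
    finally have "i \<le> ?p j + card (?S \<inter> {..i})"
      using i by (simp add: card_column_entries[OF strict j])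
    then show ?thesis
      by (simp add: entry_le_iff[OF strict cell])
  qed
  with ssyt show "U \<in> SF lam mu"
    by (auto simp: SF_def skew_diagram_eq_column_shape lam mu)
qed

section \<open>The bijection\<close>

text \<open>Columns beyond the first part of \<open>lam\<close> are empty and so is the reflected complement
  prescribed there, which allows quantifying over all columns.\<close>

lemma is_Phi_image_iff:
  assumes lam: "is_partition lam" and mu: "is_partition mu"
  shows "is_Phi_image lam mu T U \<longleftrightarrow>
    U \<in> fillings (skew_diagram lam mu) \<and>
    columns_strictly_increasing (skew_diagram lam mu) U \<and>
    (\<forall>j \<ge> 1. column_entries (skew_diagram lam mu) U j =
       reflected_complement (length lam) (part (conjugate lam) j) (column_entries (diagram mu) T j))"
proof -
  define P where "P j \<longleftrightarrow> column_entries (skew_diagram lam mu) U j =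
    reflected_complement (length lam) (part (conjugate lam) j) (column_entries (diagram mu) T j)"
    for j
  have "P j" if "1 \<le> j" "part lam 1 < j" for j
    using that part_conjugate_eq_0[of lam j]
    by (simp add: P_def skew_diagram_eq_column_shape lam mu column_entries_column_shape
        reflected_complement_def)
  then have "(\<forall>j \<in> {1..part lam 1}. P j) \<longleftrightarrow> (\<forall>j \<ge> 1. P j)"
    by (metis atLeastAtMost_iff not_le)
  then show ?thesis
    unfolding is_Phi_image_def P_def reflected_complement_def by simp
qed

text \<open>Both row conditions are comparisons of column sets by \<open>rows_weakly_increasing_iff\<close>, and these
  correspond to each other under complementation.\<close>

lemma rows_weakly_increasing_Phi_image_iff:
  assumes lam: "is_partition lam" and mu: "is_partition mu"
    and sub: "diagram mu \<subseteq> diagram lam"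
    and T: "columns_strictly_increasing (diagram mu) T"
    and E: "\<And>j. 1 \<le> j \<Longrightarrow> column_entries (diagram mu) T j
      \<subseteq> {length lam + 1 - part (conjugate lam) j..length lam}"
    and U: "is_Phi_image lam mu T U"
  shows "rows_weakly_increasing (diagram mu) T \<longleftrightarrow>
    rows_weakly_increasing (skew_diagram lam mu) U"
proof -
  let ?p = "part (conjugate mu)" and ?q = "part (conjugate lam)"
  let ?E = "column_entries (diagram mu) T"
  let ?B = "column_entries (skew_diagram lam mu) U"
  note dmu = diagram_eq_column_shape[OF mu]
  note skew = skew_diagram_eq_column_shape[OF lam mu]
  have cardE: "card (?E j) = ?p j" if "1 \<le> j" for j
    using card_column_entries[of "\<lambda>_. 0" ?p T j] T that by (simp add: dmu)
  have B: "?B j = reflected_complement (length lam) (?q j) (?E j)" if "1 \<le> j" for j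
    using U that by (simp add: is_Phi_image_iff[OF lam mu])
  have "rows_weakly_increasing (diagram mu) T \<longleftrightarrow>
      (\<forall>j j' m. 1 \<le> j \<longrightarrow> j < j' \<longrightarrow> card (?E j' \<inter> {..m}) \<le> card (?E j \<inter> {..m}))"
    using rows_weakly_increasing_iff[of "\<lambda>_. 0" ?p T] T part_conjugate_antimono[OF mu]
    by (simp add: dmu)
  also have "\<dots> \<longleftrightarrow> (\<forall>j j'. 1 \<le> j \<longrightarrow> j < j' \<longrightarrow>
      (\<forall>m. card (?E j' \<inter> {..m}) \<le> card (?E j \<inter> {..m})))"
    by blast
  also have "\<dots> \<longleftrightarrow> (\<forall>j j'. 1 \<le> j \<longrightarrow> j < j' \<longrightarrow>
      (\<forall>m. ?p j' + card (?B j' \<inter> {..m}) \<le> ?p j + card (?B j \<inter> {..m})))"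
  proof -
    have "(\<forall>m. card (?E j' \<inter> {..m}) \<le> card (?E j \<inter> {..m})) \<longleftrightarrow>
        (\<forall>m. ?p j' + card (?B j' \<inter> {..m}) \<le> ?p j + card (?B j \<inter> {..m}))"
      if "1 \<le> j" "j < j'" for j j'
      using dominance_reflected_complement[OF part_conjugate_antimono[OF lam, of j j']
          part_conjugate_le_length[OF lam, of j] E[of j] E[of j']] that
      by (simp add: B cardE)
    then show ?thesis
      by blast
  qed
  also have "\<dots> \<longleftrightarrow> (\<forall>j j' m. 1 \<le> j \<longrightarrow> j < j' \<longrightarrow>
      ?p j' + card (?B j' \<inter> {..m}) \<le> ?p j + card (?B j \<inter> {..m}))"
    by blast
  also have "\<dots> \<longleftrightarrow> rows_weakly_increasing (skew_diagram lam mu) U"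
    using rows_weakly_increasing_iff[of ?p ?q U] U part_conjugate_antimono[OF mu]
      part_conjugate_antimono[OF lam] part_conjugate_mono[OF lam mu sub]
    by (simp add: skew is_Phi_image_iff[OF lam mu])
  finally show ?thesis .
qed

lemma Phi_image_ex1:
  assumes lam: "is_partition lam" and mu: "is_partition mu"
    and sub: "diagram mu \<subseteq> diagram lam" and T: "T \<in> OOT lam mu"
  shows "\<exists>!U. is_Phi_image lam mu T U"
proof -
  let ?p = "part (conjugate mu)" and ?q = "part (conjugate lam)"
  let ?E = "column_entries (diagram mu) T"
  note skew = skew_diagram_eq_column_shape[OF lam mu]
  have E: "?E j \<subseteq> {length lam + 1 - ?q j..length lam}" if "1 \<le> j" for j
    using T that by (simp add: OOT_iff[OF lam mu])
  have "card (?E j) = ?p j" if "1 \<le> j" for j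
    using card_column_entries[of "\<lambda>_. 0" ?p T j] T that
    by (simp add: OOT_def SSYT_def diagram_eq_column_shape[OF mu])
  then have "card (reflected_complement (length lam) (?q j) (?E j)) = ?q j - ?p j"
    if "1 \<le> j" for j
    using card_reflected_complement[OF part_conjugate_le_length[OF lam that] E[OF that]] that
    by simp
  moreover have "finite (reflected_complement (length lam) (?q j) (?E j))"
    "reflected_complement (length lam) (?q j) (?E j) \<subseteq> {1..}" for j
    by (auto simp: reflected_complement_def)
  ultimately have sets: "finite (reflected_complement (length lam) (?q j) (?E j)) \<and>
      reflected_complement (length lam) (?q j) (?E j) \<subseteq> {1..} \<and>
      card (reflected_complement (length lam) (?q j) (?E j)) = ?q j - ?p j" if "1 \<le> j" for j
    using that by blast
  obtain U where "U \<in> fillings (column_shape ?p ?q)"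
    "columns_strictly_increasing (column_shape ?p ?q) U"
    "\<And>j. 1 \<le> j \<Longrightarrow>
      column_entries (column_shape ?p ?q) U j = reflected_complement (length lam) (?q j) (?E j)"
    using column_strict_filling_exists[of
        "\<lambda>j. reflected_complement (length lam) (?q j) (?E j)" ?q ?p, OF sets] by blast
  then have "is_Phi_image lam mu T U"
    by (simp add: is_Phi_image_iff[OF lam mu] skew)
  moreover have "V = W" if "is_Phi_image lam mu T V" "is_Phi_image lam mu T W" for V W
    using that column_strict_filling_unique[of V ?p ?q W]
    by (simp add: is_Phi_image_iff[OF lam mu] skew)
  ultimately show ?thesis
    by blast
qed

lemma Phi_image_in_SF:
  assumes lam: "is_partition lam" and mu: "is_partition mu"
    and sub: "diagram mu \<subseteq> diagram lam" and T: "T \<in> OOT lam mu"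
    and U: "is_Phi_image lam mu T U"
  shows "U \<in> SF lam mu"
proof -
  have "rows_weakly_increasing (skew_diagram lam mu) U"
    using rows_weakly_increasing_Phi_image_iff[OF lam mu sub _ _ U] T
    by (auto simp: OOT_iff[OF lam mu] SSYT_def)
  with U show ?thesis
    by (auto simp: SF_iff[OF lam mu] is_Phi_image_iff[OF lam mu] SSYT_def reflected_complement_def)
qed

lemma Phi_image_surj:
  assumes lam: "is_partition lam" and mu: "is_partition mu"
    and sub: "diagram mu \<subseteq> diagram lam" and U: "U \<in> SF lam mu"
  obtains T where "T \<in> OOT lam mu" "is_Phi_image lam mu T U"
proof -
  let ?p = "part (conjugate mu)" and ?q = "part (conjugate lam)" and ?d = "length lam"
  let ?B = "column_entries (skew_diagram lam mu) U"
  define E where "E j = {e \<in> {?d + 1 - ?q j..?d}. ?d + 1 - e \<notin> ?B j}" for j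
  have ssyt: "U \<in> SSYT (skew_diagram lam mu)"
    and B: "\<And>j. 1 \<le> j \<Longrightarrow> ?B j \<subseteq> {1..?q j}"
    using U by (auto simp: SF_iff[OF lam mu])
  have q: "?q j \<le> ?d" if "1 \<le> j" for j
    by (rule part_conjugate_le_length[OF lam that])
  have E: "E j \<subseteq> {?d + 1 - ?q j..?d}" for j
    by (auto simp: E_def)
  have compl: "reflected_complement ?d (?q j) (E j) = ?B j" if "1 \<le> j" for j
    unfolding E_def by (rule reflected_complement_surj[OF q[OF that] B[OF that]])
  have cardB: "card (?B j) = ?q j - ?p j" if "1 \<le> j" for j
    using card_column_entries[of ?p ?q U j] ssyt that
    by (simp add: SSYT_def skew_diagram_eq_column_shape[OF lam mu])
  have sets: "finite (E j) \<and> E j \<subseteq> {1..} \<and> card (E j) = ?p j - 0" if j: "1 \<le> j" for j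
  proof (intro conjI)
    show "finite (E j)"
      by (simp add: E_def)
    show "E j \<subseteq> {1..}"
      using q[OF j] by (auto simp: E_def)
    show "card (E j) = ?p j - 0"
      using card_reflected_complement[OF q[OF j] E] compl[OF j] cardB[OF j]
        part_conjugate_mono[OF lam mu sub j] by simp
  qed
  obtain T where T: "T \<in> fillings (diagram mu)" "columns_strictly_increasing (diagram mu) T"
    and entries: "\<And>j. 1 \<le> j \<Longrightarrow> column_entries (diagram mu) T j = E j"
    unfolding diagram_eq_column_shape[OF mu]
    using column_strict_filling_exists[of E ?p "\<lambda>_. 0", OF sets] by blast
  have image: "is_Phi_image lam mu T U"
    using ssyt compl entries by (simp add: is_Phi_image_iff[OF lam mu] SSYT_def)
  have "rows_weakly_increasing (diagram mu) T"
    using rows_weakly_increasing_Phi_image_iff[OF lam mu sub T(2) _ image] E entries ssyt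
    by (simp add: SSYT_def)
  then have "T \<in> OOT lam mu"
    using T E entries by (simp add: OOT_iff[OF lam mu] SSYT_def)
  with image that show ?thesis
    by blast
qed

lemma Phi_image_inj:
  assumes lam: "is_partition lam" and mu: "is_partition mu"
    and T: "T \<in> OOT lam mu" "is_Phi_image lam mu T U"
    and T': "T' \<in> OOT lam mu" "is_Phi_image lam mu T' U"
  shows "T = T'"
proof -
  let ?q = "part (conjugate lam)" and ?d = "length lam"
  have recover: "column_entries (diagram mu) S j =
      {e \<in> {?d + 1 - ?q j..?d}. ?d + 1 - e \<notin> column_entries (skew_diagram lam mu) U j}"
    if "S \<in> OOT lam mu" "is_Phi_image lam mu S U" "1 \<le> j" for S j
  proof -
    have "column_entries (diagram mu) S j \<subseteq> {?d + 1 - ?q j..?d}"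
      using that by (simp add: OOT_iff[OF lam mu])
    moreover have "column_entries (skew_diagram lam mu) U j =
        reflected_complement ?d (?q j) (column_entries (diagram mu) S j)"
      using that by (simp add: is_Phi_image_iff[OF lam mu])
    ultimately show ?thesis
      using reflected_complement_involution[OF part_conjugate_le_length[OF lam that(3)]] by simp
  qed
  have "column_entries (diagram mu) T j = column_entries (diagram mu) T' j" if "1 \<le> j" for j
    using recover[OF T that] recover[OF T' that] by simp
  then show ?thesis
    using T(1) T'(1) column_strict_filling_unique[of T "\<lambda>_. 0" "part (conjugate mu)" T']
    by (simp add: OOT_def SSYT_def diagram_eq_column_shape[OF mu])
qed

theorem corollary4p16:
  fixes lam mu :: "nat list"
  assumes "is_partition lam" and "is_partition mu"
    and "diagram mu \<subseteq> diagram lam"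
  shows "(\<forall>T \<in> OOT lam mu. \<exists>!U. is_Phi_image lam mu T U) \<and>
         bij_betw (Phi lam mu) (OOT lam mu) (SF lam mu)"
proof
  show ex1: "\<forall>T \<in> OOT lam mu. \<exists>!U. is_Phi_image lam mu T U"
    by (rule ballI) (rule Phi_image_ex1[OF assms])
  have Phi: "is_Phi_image lam mu T (Phi lam mu T)" if "T \<in> OOT lam mu" for T
    unfolding Phi_def by (rule theI'[OF bspec[OF ex1 that]])
  have Phi_eq: "Phi lam mu T = U" if "T \<in> OOT lam mu" "is_Phi_image lam mu T U" for T U
    using bspec[OF ex1 that(1)] Phi[OF that(1)] that(2) by metis
  show "bij_betw (Phi lam mu) (OOT lam mu) (SF lam mu)"
  proof (rule bij_betw_imageI)
    show "inj_on (Phi lam mu) (OOT lam mu)"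
    proof (rule inj_onI)
      fix T T' assume *: "T \<in> OOT lam mu" "T' \<in> OOT lam mu" "Phi lam mu T = Phi lam mu T'"
      show "T = T'"
        using Phi_image_inj[OF assms(1,2) *(1) Phi[OF *(1)] *(2)] Phi[OF *(2)] *(3) by simp
    qed
    show "Phi lam mu ` OOT lam mu = SF lam mu"
    proof
      show "Phi lam mu ` OOT lam mu \<subseteq> SF lam mu"
        using Phi_image_in_SF[OF assms] Phi by blast
      show "SF lam mu \<subseteq> Phi lam mu ` OOT lam mu"
      proof
        fix U assume "U \<in> SF lam mu"
        then obtain T where "T \<in> OOT lam mu" "is_Phi_image lam mu T U"
          using Phi_image_surj[OF assms] by blast
        then show "U \<in> Phi lam mu ` OOT lam mu"
          using Phi_eq by blast
      qed
    qed
  qed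
qed

end
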